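(* The $6$-tuple of real numbers $$\mu_1=\frac{13}{9},\quad \mu_2=-\frac{25}{36},\quad \mu_3=\frac19,\quad \mu_4=\mu_5=\mu_6=0,$$ is a multiplier for the six-step BDF method.
   Context: The generating polynomial of the six-step BDF (backward difference formula) method is $$\alpha(\zeta)=\sum_{j=1}^6\frac1j\,\zeta^{6-j}(\zeta-1)^j=\sum_{j=0}^6\alpha_j\zeta^j .$$ A $6$-tuple $(\mu_1,\dots,\mu_6)$ of real numbers is called a multiplier for the six-step BDF method if, with $\mu(\zeta):=\zeta^6-\mu_1\zeta^5-\mu_2\zeta^4-\cdots-\mu_6$, all of the following hold: (i) (A-stability condition) $\operatorname{Re}\dfrac{\alpha(\zeta)}{\mu(\zeta)}>0$ for all $\zeta\in\mathbb{C}$ with $|\zeta|>1$; (ii) the polynomials $\alpha$ and $\mu$ have no common (nonconstant) divisor; (iii) (positivity property) $1-\mu_1\cos x-\mu_2\cos(2x)-\cdots-\mu_6\cos(6x)>0$ for all $x\in\mathbb{R}$. *)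

theory Defs
  imports "HOL-Analysis.Analysis" "HOL-Computational_Algebra.Computational_Algebra"
begin

definition bdf6_poly :: "complex poly" where
  "bdf6_poly = (\<Sum>j::nat = 1..6. smult (1 / of_nat j) (monom 1 (6 - j) * [:-1, 1:] ^ j))"

text \<open>
  A 6-tuple of real numbers is represented by a function on the natural numbers of which
  only the values at 1, ..., 6 are used.
\<close>

definition mult_poly :: "(nat \<Rightarrow> real) \<Rightarrow> complex poly" where
  "mult_poly \<mu> = monom 1 6 - (\<Sum>j = 1..6. monom (of_real (\<mu> j)) (6 - j))"

text \<open>
  In the A-stability condition the quotient is 0 wherever the denominator vanishes, so the strict
  inequality also excludes zeros of the denominator outside the closed unit disc.
  Coprimality of real polynomials does not change when passing from the real to the complex field.
\<close>

definition bdf6_multiplier :: "(nat \<Rightarrow> real) \<Rightarrow> bool" where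
  "bdf6_multiplier \<mu> \<longleftrightarrow>
     (\<forall>z. norm z > 1 \<longrightarrow> Re (poly bdf6_poly z / poly (mult_poly \<mu>) z) > 0) \<and>
     coprime bdf6_poly (mult_poly \<mu>) \<and>
     (\<forall>x::real. 1 - (\<Sum>j = 1..6. \<mu> j * cos (of_nat j * x)) > 0)"

end

theory Submission
  imports Defs "HOL-Complex_Analysis.Conformal_Mappings"
begin

text \<open>
  Put \<open>w = 1/z\<close>. For \<open>\<bar>z\<bar> > 1\<close> the quotient \<open>\<alpha>(z)/\<mu>(z)\<close> equals \<open>f w = A w / M w\<close>, where \<open>A\<close> and \<open>M\<close>
  are the reversed polynomials (\<open>bdf6_rev\<close> and \<open>mult_rev\<close>) and \<open>w\<close> lies in the
  open unit disc. The zeros of \<open>M\<close> are \<open>2\<close>, \<open>2\<close> and \<open>9/4\<close>, so \<open>f\<close> is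
  holomorphic on a neighbourhood of the closed disc, and the sign of its real part in the disc is governed by the sign on the unit circle
  (\<open>Re_pos_if_Re_nonneg_on_frontier\<close>).

  On the unit circle the sign of \<open>Re (f w)\<close> is that of \<open>Re (A w * cnj (M w))\<close>, which is a trigonometric
  polynomial, hence a polynomial in \<open>c = Re w\<close>. Since \<open>A 1 = 0\<close> it is divisible by
  \<open>1 - c\<close>, and the cofactor is, up to the factor 270, a quintic with integer coefficients
  (\<open>laurent_identity\<close>). Explicit decompositions into nonnegative terms show that
  this quintic is nonnegative on \<open>[-1, 1]\<close> (\<open>circle_poly_nonneg\<close>).

  The polynomial \<open>\<mu>(z) = z^3 (z - 1/2)^2 (z - 4/9)\<close> has only rational roots, and \<open>\<alpha>\<close> vanishes at none of
  them; over an algebraically closed field this gives coprimality. The positivity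
  property is the positivity of a cubic in \<open>cos x\<close> on \<open>[-1, 1]\<close>.
\<close>

section \<open>A minimum principle for the real part\<close>

text \<open>
  The maximum principle gives the weak inequality inside. A nonconstant holomorphic function
  is open, so its image lies in the interior of the closed right half plane, which makes the
  inequality strict. One point with positive real part settles the constant case.
\<close>

lemma Re_pos_if_Re_nonneg_on_frontier:
  assumes "open S" "connected S" "bounded S"
    and holf: "f holomorphic_on S" and contf: "continuous_on (closure S) f"
    and frontier: "\<And>w. w \<in> frontier S \<Longrightarrow> Re (f w) \<ge> 0"
    and pos: "a \<in> S" "Re (f a) > 0" and "z \<in> S"
  shows "Re (f z) > 0"
proof (cases "f constant_on S")
  case True
  then show ?thesis
    using pos \<open>z \<in> S\<close> unfolding constant_on_def by metis
next
  case False
  have "Re (- f w) \<le> 0" if "w \<in> S" for w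
  proof (rule maximum_real_frontier[of "\<lambda>w. - f w" S])
    show "(\<lambda>w. - f w) holomorphic_on interior S"
      using holf \<open>open S\<close> by (simp add: interior_open holomorphic_on_minus)
    show "continuous_on (closure S) (\<lambda>w. - f w)"
      by (rule continuous_on_minus[OF contf])
  qed (use frontier \<open>bounded S\<close> that in simp_all)
  then have "f ` S \<subseteq> {w. Re w \<ge> 0}"
    by auto
  moreover have "open (f ` S)"
    by (rule open_mapping_thm[OF holf \<open>open S\<close> \<open>connected S\<close> \<open>open S\<close> subset_refl False])
  ultimately have "f ` S \<subseteq> interior {w. Re w \<ge> 0}"
    by (rule interior_maximal)
  moreover have "interior {w. Re w \<ge> 0} = {w. Re w > 0}"
    using interior_halfspace_ge[of "1 :: complex" 0] by (simp add: inner_complex_def)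
  ultimately show ?thesis
    using \<open>z \<in> S\<close> by blast
qed

section \<open>Coprimality over an algebraically closed field\<close>

lemma coprime_if_no_common_root:
  fixes p q :: "'a :: alg_closed_field poly"
  assumes "\<And>z. poly q z = 0 \<Longrightarrow> poly p z \<noteq> 0"
  shows "coprime p q"
proof (rule coprimeI)
  fix d assume d: "d dvd p" "d dvd q"
  have no_root: "poly d z \<noteq> 0" for z
    using assms d by (metis dvd_trans poly_eq_0_iff_dvd)
  then have "d \<noteq> 0"
    by auto
  moreover have "\<not> degree d > 0"
    using no_root alg_closed_imp_poly_has_root by blast
  ultimately show "is_unit d"
    by (simp add: is_unit_iff_degree)
qed

section \<open>The two polynomials and their reversals\<close>

lemma poly_bdf6_poly:
  "poly bdf6_poly z =
     49/20*z^6 - 6*z^5 + 15/2*z^4 - 20/3*z^3 + 15/4*z^2 - 6/5*z + 1/6"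
proof -
  have "{1..6::nat} = {1,2,3,4,5,6}"
    by auto
  then show ?thesis
    unfolding bdf6_poly_def
    by (simp add: poly_monom field_simps power_numeral_reduce)
qed

lemma poly_mult_poly:
  assumes \<mu>: "\<mu> 1 = 13/9" "\<mu> 2 = - (25/36)" "\<mu> 3 = 1/9" "\<mu> 4 = 0" "\<mu> 5 = 0" "\<mu> 6 = 0"
  shows "poly (mult_poly \<mu>) z = z^3 * (z - 1/2)^2 * (z - 4/9)"
proof -
  have "{1..6::nat} = {1,2,3,4,5,6}"
    by auto
  then have "poly (mult_poly \<mu>) z = z^6 - 13/9*z^5 + 25/36*z^4 - 1/9*z^3"
    unfolding mult_poly_def by (simp add: \<mu> \<mu>(1)[unfolded One_nat_def] poly_monom)
  also have "\<dots> = z^3 * (z - 1/2)^2 * (z - 4/9)"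
    by (simp add: field_simps power_numeral_reduce)
  finally show ?thesis .
qed

definition bdf6_rev :: "complex \<Rightarrow> complex" where
  "bdf6_rev w = 49/20 - 6*w + 15/2*w^2 - 20/3*w^3 + 15/4*w^4 - 6/5*w^5 + w^6/6"

definition mult_rev :: "complex \<Rightarrow> complex" where
  "mult_rev w = (1 - w/2)^2 * (1 - 4/9*w)"

lemma poly_bdf6_poly_eq_rev:
  assumes "w * z = 1"
  shows "poly bdf6_poly z = z^6 * bdf6_rev w"
proof -
  have cancel: "w * (z * x) = x" for x
    using assms by (simp flip: mult.assoc)
  show ?thesis
    unfolding poly_bdf6_poly bdf6_rev_def
    by (simp add: algebra_simps power_numeral_reduce assms cancel)
qed

lemma mult_factors_eq_rev:
  assumes "w * z = 1"
  shows "z^3 * (z - 1/2)^2 * (z - 4/9) = z^6 * mult_rev w"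
proof -
  have "z * (1 - w/2) = z - 1/2" "z * (1 - 4/9*w) = z - 4/9"
    using assms by (simp_all add: algebra_simps)
  then have "z^3 * (z - 1/2)^2 * (z - 4/9) = z^3 * (z * (1 - w/2))^2 * (z * (1 - 4/9*w))"
    by simp
  also have "\<dots> = z^6 * mult_rev w"
    unfolding mult_rev_def by (simp add: power_mult_distrib power_numeral_reduce mult_ac)
  finally show ?thesis .
qed

lemma mult_rev_nonzero:
  assumes "norm w \<le> 1"
  shows "mult_rev w \<noteq> 0"
proof -
  have "norm (w/2) < 1" "norm (4/9*w) < 1"
    using assms by (simp_all add: norm_mult norm_divide)
  then have "w/2 \<noteq> 1" "4/9*w \<noteq> 1"
    by (metis norm_one less_irrefl)+
  then show ?thesis
    unfolding mult_rev_def by simp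
qed

section \<open>The real part on the unit circle\<close>

text \<open>
  This is the quintic cofactor of \<open>1 - c\<close>. It is used at real points, where its sign
  matters, and at complex ones, where it arises from an algebraic identity.
\<close>

definition circle_poly :: "'a::comm_ring_1 \<Rightarrow> 'a" where
  "circle_poly c = 71 + 611*c + 1334*c^2 - 5150*c^3 + 4784*c^4 - 1440*c^5"

text \<open>
  For \<open>c \<le> 0\<close> the terms of degree at least 3 are nonnegative and the quadratic part has negative
  discriminant. For \<open>c \<ge> 0\<close> split off \<open>1440 c^4 (1 - c)\<close> and the constant \<open>71\<close>; what remains is \<open>c\<close>
  times a cubic whose minimum on \<open>[0, 1]\<close> is positive and is attained near \<open>7/8\<close>, so that dividing
  the cubic by \<open>(c - 7/8)^2\<close> leaves a quotient and a remainder that are visibly positive.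
\<close>

lemma circle_poly_nonneg:
  fixes c :: real
  assumes "\<bar>c\<bar> \<le> 1"
  shows "circle_poly c \<ge> 0"
proof (cases "c \<ge> 0")
  case True
  have "circle_poly c = 71 + c * ((c - 7/8)^2 * (3344*c + 702) + 9/4*c + 2353/32)
      + 1440 * (c^4 * (1 - c))"
    unfolding circle_poly_def by (simp add: field_simps power_numeral_reduce)
  then show ?thesis
    using True assms by simp
next
  case False
  have "circle_poly c = 1334 * (c + 611/2668)^2 + 5535/5336
      + 5150 * (-c)^3 + 4784 * (-c)^4 + 1440 * (-c)^5"
    unfolding circle_poly_def by (simp add: field_simps power_numeral_reduce)
  moreover have "(-c)^3 \<ge> 0" "(-c)^4 \<ge> 0" "(-c)^5 \<ge> 0"
    using False by (intro zero_le_power; simp)+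
  ultimately show ?thesis
    by (smt (verit) zero_le_power2 divide_nonneg_nonneg)
qed

text \<open>
  For \<open>v = cnj w\<close> on the unit circle the left side is \<open>270 Re (A w * cnj (M w))\<close>. With \<open>v = 1/w\<close> it is a
  Laurent polynomial in \<open>w\<close> that is symmetric under \<open>w \<mapsto> 1/w\<close>, hence a polynomial in \<open>w + 1/w\<close>.
\<close>

lemma laurent_identity:
  fixes w v :: complex
  assumes "w * v = 1"
  shows "135 * (bdf6_rev w * mult_rev v + bdf6_rev v * mult_rev w)
    = (1 - (w + v)/2) * circle_poly ((w + v)/2)"
proof -
  \<comment> \<open>The factors 60, 36 and 8 clear all denominators; they fit together as \<open>60 * 36 = 16 * 135\<close>.\<close>
  have A: "60 * bdf6_rev x
      = 147 - 360*x + 450*x^2 - 400*x^3 + 225*x^4 - 72*x^5 + 10*x^6" for x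
    unfolding bdf6_rev_def by (simp add: algebra_simps)
  have M: "36 * mult_rev x = 36 - 52*x + 25*x^2 - 4*x^3" for x
    unfolding mult_rev_def by (simp add: field_simps power_numeral_reduce)
  have C: "8 * circle_poly (x/2)
      = 568 + 2444*x + 2668*x^2 - 5150*x^3 + 2392*x^4 - 360*x^5" for x :: complex
    unfolding circle_poly_def by (simp add: field_simps power_numeral_reduce)
  \<comment> \<open>After expansion these rules reduce every mixed monomial to a pure power of \<open>v\<close> or of \<open>w\<close>.\<close>
  have cancel: "v * w = 1" "v * (w * x) = x" for x
    using assms by (simp_all add: mult.commute flip: mult.assoc)
  have "16 * (135 * (bdf6_rev w * mult_rev v + bdf6_rev v * mult_rev w))
      = (60 * bdf6_rev w) * (36 * mult_rev v) + (60 * bdf6_rev v) * (36 * mult_rev w)"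
    by (simp add: algebra_simps)
  also have "\<dots> = (2 - (w + v)) * (8 * circle_poly ((w + v)/2))"
    unfolding A M C by (simp add: algebra_simps power_numeral_reduce cancel)
  also have "\<dots> = 16 * ((1 - (w + v)/2) * circle_poly ((w + v)/2))"
    by (simp add: algebra_simps)
  finally show ?thesis
    by (simp only: mult_cancel_left) simp
qed

lemma Re_quotient_nonneg_on_circle:
  assumes "norm w = 1"
  shows "Re (bdf6_rev w / mult_rev w) \<ge> 0"
proof -
  have cnj: "cnj (bdf6_rev w) = bdf6_rev (cnj w)" "cnj (mult_rev w) = mult_rev (cnj w)"
    by (simp_all add: bdf6_rev_def mult_rev_def)
  define P where "P = bdf6_rev w * cnj (mult_rev w)"
  have c: "(w + cnj w)/2 = of_real (Re w)"
    by (simp add: complex_add_cnj)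
  have "w * cnj w = 1"
    using assms by (simp add: complex_norm_square[symmetric])
  then have "135 * (P + cnj P) = (1 - (w + cnj w)/2) * circle_poly ((w + cnj w)/2)"
    using laurent_identity[of w "cnj w"] by (simp add: P_def cnj flip: cnj)
  also have "\<dots> = of_real ((1 - Re w) * circle_poly (Re w))"
    unfolding c by (simp add: circle_poly_def)
  finally have "270 * Re P = (1 - Re w) * circle_poly (Re w)"
    by (simp add: complex_add_cnj complex_eq_iff)
  moreover have "\<bar>Re w\<bar> \<le> 1"
    using abs_Re_le_cmod[of w] assms by simp
  ultimately have "Re P \<ge> 0"
    using circle_poly_nonneg[of "Re w"] by (smt (verit) mult_nonneg_nonneg)
  then show ?thesis
    by (simp add: P_def complex_div_cnj[of _ "mult_rev w"] flip: of_real_power)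
qed

lemma Re_quotient_pos_in_disc:
  assumes "norm w < 1"
  shows "Re (bdf6_rev w / mult_rev w) > 0"
proof (rule Re_pos_if_Re_nonneg_on_frontier
    [where S = "ball 0 1" and a = 0 and f = "\<lambda>w. bdf6_rev w / mult_rev w"])
  show "(\<lambda>w. bdf6_rev w / mult_rev w) holomorphic_on ball 0 1"
    using mult_rev_nonzero
    by (intro holomorphic_intros)
       (auto simp: bdf6_rev_def[abs_def] mult_rev_def[abs_def] intro!: holomorphic_intros)
  show "continuous_on (closure (ball 0 1)) (\<lambda>w. bdf6_rev w / mult_rev w)"
    using mult_rev_nonzero
    by (intro continuous_on_divide)
       (auto simp: bdf6_rev_def[abs_def] mult_rev_def[abs_def] intro!: continuous_intros)
  show "Re (bdf6_rev 0 / mult_rev 0) > 0"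
    by (simp add: bdf6_rev_def mult_rev_def)
  show "Re (bdf6_rev w / mult_rev w) \<ge> 0" if "w \<in> frontier (ball 0 1)" for w
    using that by (intro Re_quotient_nonneg_on_circle) simp
  show "w \<in> ball 0 1"
    using assms by simp
qed simp_all

section \<open>The cosine sum\<close>

text \<open>
  As a cubic in \<open>c = cos x\<close> the sum has its local minimum near \<open>1/2\<close>; division by \<open>(c - 1/2)^2\<close> leaves a
  quotient and a remainder that are positive for \<open>c \<le> 1\<close>.
\<close>

lemma cosine_sum_pos:
  fixes x :: real
  shows "1 - 13/9 * cos x + 25/36 * cos (2*x) - 1/9 * cos (3*x) > 0"
proof -
  define c where "c = cos x"
  have "c \<le> 1"
    by (simp add: c_def)
  have "36 * (1 - 13/9 * cos x + 25/36 * cos (2*x) - 1/9 * cos (3*x))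
      = (c - 1/2)^2 * (34 - 16*c) + (5/2 - 2*c)"
    unfolding cos_double_cos cos_treble_cos c_def
    by (simp add: field_simps power_numeral_reduce)
  also have "\<dots> > 0"
    using \<open>c \<le> 1\<close> by (intro add_nonneg_pos mult_nonneg_nonneg) auto
  finally show ?thesis
    by simp
qed

section \<open>The multiplier\<close>

theorem proposition2p1:
  fixes \<mu> :: "nat \<Rightarrow> real"
  assumes "\<mu> 1 = 13/9" and "\<mu> 2 = - (25/36)" and "\<mu> 3 = 1/9"
    and "\<mu> 4 = 0" and "\<mu> 5 = 0" and "\<mu> 6 = 0"
  shows "bdf6_multiplier \<mu>"
  unfolding bdf6_multiplier_def
proof (intro conjI allI impI)
  note mult = poly_mult_poly[OF assms]
  show "Re (poly bdf6_poly z / poly (mult_poly \<mu>) z) > 0" if "norm z > 1" for z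
  proof -
    have z: "z \<noteq> 0" "1/z * z = 1" "norm (1/z) < 1"
      using that by (auto simp: norm_divide divide_simps)
    then have "poly bdf6_poly z / poly (mult_poly \<mu>) z = bdf6_rev (1/z) / mult_rev (1/z)"
      by (simp only: mult mult_factors_eq_rev[OF z(2)] poly_bdf6_poly_eq_rev[OF z(2)]) simp
    then show ?thesis
      using Re_quotient_pos_in_disc[OF z(3)] by simp
  qed
  show "coprime bdf6_poly (mult_poly \<mu>)"
  proof (rule coprime_if_no_common_root)
    fix z assume "poly (mult_poly \<mu>) z = 0"
    then have "z = 0 \<or> z = 1/2 \<or> z = 4/9"
      by (auto simp: mult)
    moreover have "poly bdf6_poly 0 \<noteq> 0" "poly bdf6_poly (1/2) \<noteq> 0"
      "poly bdf6_poly (4/9) \<noteq> 0"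
      by (simp_all add: poly_bdf6_poly power_divide)
    ultimately show "poly bdf6_poly z \<noteq> 0"
      by metis
  qed
  have "{1..6::nat} = {1,2,3,4,5,6}"
    by auto
  then show "1 - (\<Sum>j = 1..6. \<mu> j * cos (of_nat j * x)) > 0" for x :: real
    using cosine_sum_pos[of x] by (simp add: assms assms(1)[unfolded One_nat_def])
qed

end
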